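(* For $u,v,n \in \mathbb{N}$, let $C'_4(u,v,n)$ denote the number of partitions of $n$ into $u$ distinct parts congruent to $3$ modulo $4$ and $v$ distinct parts congruent to $1$ modulo $4$ (all parts distinct). Let $D'_4(u,v,n)$ denote the number of partitions $\lambda_1 + \cdots + \lambda_s$ of $n$ (positive integer parts, $\lambda_1\ge\cdots\ge\lambda_s$) such that $u$ equals the number of parts congruent to $0$ or $3$ modulo $4$ plus twice the number of parts congruent to $2$ modulo $8$, and $v$ equals the number of parts congruent to $0$ or $1$ modulo $4$ plus twice the number of parts congruent to $6$ modulo $8$, satisfying the following conditions: (1) for all $i$, $\lambda_i \neq 2$; (2) for all $1\le i<s$: $\lambda_i - \lambda_{i+1} \in \{5,6,8,9\}$ or $\geq 11$ if $\lambda_{i} \equiv 0 \pmod 8$; $\lambda_i - \lambda_{i+1} = 2$ or $\geq 5$ if $\lambda_{i} \equiv 1 \pmod 8$; $\lambda_i - \lambda_{i+1} = 11$ or $\geq 13$ if $\lambda_{i} \equiv 2 \pmod 8$; $\lambda_i - \lambda_{i+1} \geq 7$ if $\lambda_{i} \equiv 3 \pmod 8$; $\lambda_i - \lambda_{i+1} = 5$ or $\geq 7$ if $\lambda_{i} \equiv 4 \pmod 8$; $\lambda_i - \lambda_{i+1} \in \{2,3,5,6\}$ or $\geq 8$ if $\lambda_{i} \equiv 5 \pmod 8$; $\lambda_i - \lambda_{i+1} \in \{3,4,6,7\}$ or $\geq 9$ if $\lambda_{i} \equiv 6 \pmod 8$; $\lambda_i - \lambda_{i+1} = 8$ or $\geq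 10$ if $\lambda_{i} \equiv 7 \pmod 8$. Then $C'_4(u,v,n)=D'_4(u,v,n)$ for all $u,v,n\in\mathbb{N}$. *)

theory Defs
  imports Main
begin

definition C4' :: "nat \<Rightarrow> nat \<Rightarrow> nat \<Rightarrow> nat" where
  "C4' u v n = card {S :: nat set. finite S \<and> (\<forall>x\<in>S. x mod 4 = 1 \<or> x mod 4 = 3)
      \<and> \<Sum>S = n
      \<and> card {x\<in>S. x mod 4 = 3} = u \<and> card {x\<in>S. x mod 4 = 1} = v}"

definition diff_ok :: "nat \<Rightarrow> nat \<Rightarrow> bool" where
  "diff_ok a b = (let d = int a - int b in
     (a mod 8 = 0 \<longrightarrow> d \<in> {5,6,8,9} \<or> d \<ge> 11) \<and>
     (a mod 8 = 1 \<longrightarrow> d = 2 \<or> d \<ge> 5) \<and>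
     (a mod 8 = 2 \<longrightarrow> d = 11 \<or> d \<ge> 13) \<and>
     (a mod 8 = 3 \<longrightarrow> d \<ge> 7) \<and>
     (a mod 8 = 4 \<longrightarrow> d = 5 \<or> d \<ge> 7) \<and>
     (a mod 8 = 5 \<longrightarrow> d \<in> {2,3,5,6} \<or> d \<ge> 8) \<and>
     (a mod 8 = 6 \<longrightarrow> d \<in> {3,4,6,7} \<or> d \<ge> 9) \<and>
     (a mod 8 = 7 \<longrightarrow> d = 8 \<or> d \<ge> 10))"

definition D4' :: "nat \<Rightarrow> nat \<Rightarrow> nat \<Rightarrow> nat" where
  "D4' u v n = card {xs :: nat list. sorted_wrt (\<ge>) xs \<and> (\<forall>x\<in>set xs. x > 0)
      \<and> sum_list xs = n
      \<and> (\<forall>x\<in>set xs. x \<noteq> 2)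
      \<and> (\<forall>i. i + 1 < length xs \<longrightarrow> diff_ok (xs ! i) (xs ! (i + 1)))
      \<and> u = length (filter (\<lambda>x. x mod 4 = 0 \<or> x mod 4 = 3) xs)
            + 2 * length (filter (\<lambda>x. x mod 8 = 2) xs)
      \<and> v = length (filter (\<lambda>x. x mod 4 = 0 \<or> x mod 4 = 1) xs)
            + 2 * length (filter (\<lambda>x. x mod 8 = 6) xs)}"

end

theory Submission
  imports Defs "HOL-Computational_Algebra.Polynomial"
begin

text \<open>
  Weight a partition by \<open>a\<^sup>u b\<^sup>v q\<^sup>n\<close> and let \<open>\<ell>\<^sub>m\<close> be the weighted count of the admissible partitions
  with parts at most \<open>8m - 4\<close>.  Removing the largest part yields linear recurrences for \<open>\<ell>\<^sub>m\<close>
  and for the count \<open>\<alpha>\<^sub>m\<close> of partitions that may follow the part \<open>8m + 4\<close>.  These recurrences imply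
  \<open>\<ell>\<^bsub>m+1\<^esub>(a, b) = (1 + b q) (1 + a q\<^sup>3) \<alpha>\<^sub>m(a q\<^sup>4, b q\<^sup>4)\<close>.
  Since \<open>\<ell>\<^sub>m\<close> and \<open>\<alpha>\<^sub>m\<close> have the same \<open>q\<close>-adic limit, iterating this gives
  \<open>\<Prod>\<^sub>j (1 + b q\<^bsup>4j+1\<^esup>) (1 + a q\<^bsup>4j+3\<^esup>)\<close> for the limit, which is the weighted count of
  partitions into distinct odd parts.
\<close>

section \<open>Weights, admissible lists and their generating functions\<close>

text \<open>The amounts that one part \<open>k\<close> adds to \<open>u\<close> (here) and to
  \<open>v\<close> (\<open>mult1\<close>).\<close>

definition mult3 :: "nat \<Rightarrow> nat" where
  "mult3 k = (if k mod 4 = 0 \<or> k mod 4 = 3 then 1 else 0) + (if k mod 8 = 2 then 2 else 0)"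

definition mult1 :: "nat \<Rightarrow> nat" where
  "mult1 k = (if k mod 4 = 0 \<or> k mod 4 = 1 then 1 else 0) + (if k mod 8 = 6 then 2 else 0)"

definition part_wt :: "'a::comm_ring_1 \<Rightarrow> 'a \<Rightarrow> 'a \<Rightarrow> nat \<Rightarrow> 'a" where
  "part_wt a b q k = a ^ mult3 k * b ^ mult1 k * q ^ k"

definition admissible :: "nat list \<Rightarrow> bool" where
  "admissible xs \<longleftrightarrow> 0 \<notin> set xs \<and> 2 \<notin> set xs \<and> successively diff_ok xs"

text \<open>Entries decrease, so a condition on the head controls the whole list:
  \<open>T = {..<K}\<close> bounds all parts, and \<open>T = {j. diff_ok k j}\<close> gives the
  lists that may follow the part \<open>k\<close>.\<close>

definition headed :: "nat set \<Rightarrow> nat list set" where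
  "headed T = {xs. admissible xs \<and> (xs = [] \<or> hd xs \<in> T)}"

definition gf :: "'a::comm_ring_1 \<Rightarrow> 'a \<Rightarrow> 'a \<Rightarrow> nat set \<Rightarrow> 'a" where
  "gf a b q T = (\<Sum>xs\<in>headed T. prod_list (map (part_wt a b q) xs))"

lemma part_wt_shift: "part_wt a b q (8*m + r) = a ^ mult3 r * b ^ mult1 r * q ^ (8*m + r)"
proof -
  have "(8*m + r) mod 4 = r mod 4" "(8*m + r) mod 8 = r mod 8"
    by presburger+
  then show ?thesis by (simp add: part_wt_def mult3_def mult1_def)
qed

lemma diff_ok_less: "diff_ok x y \<Longrightarrow> y < x"
proof -
  assume *: "diff_ok x y"
  have "x mod 8 < 8" by simp
  then consider "x mod 8 = 0" | "x mod 8 = 1" | "x mod 8 = 2" | "x mod 8 = 3"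
    | "x mod 8 = 4" | "x mod 8 = 5" | "x mod 8 = 6" | "x mod 8 = 7" by linarith
  then show "y < x" using * by cases (auto simp: diff_ok_def Let_def)
qed

lemma finite_diff_ok [simp]: "finite {j. diff_ok k j}"
  by (rule finite_subset[of _ "{..<k}"]) (auto dest: diff_ok_less)

lemma admissible_decreasing:
  assumes "admissible xs"
  shows "sorted_wrt (>) xs"
proof -
  have "successively (>) xs"
    using assms by (auto simp: admissible_def intro: successively_mono diff_ok_less)
  then show ?thesis by (subst (asm) successively_iff_sorted_wrt_strong) auto
qed

lemma distinct_if_decreasing: "sorted_wrt (>) xs \<Longrightarrow> distinct (xs :: nat list)"
  by (induction xs) auto

lemma admissible_Cons:
  "admissible (k # xs) \<longleftrightarrow> k \<noteq> 0 \<and> k \<noteq> 2 \<and> xs \<in> headed {j. diff_ok k j}"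
  by (cases xs) (auto simp: admissible_def headed_def)

lemma finite_headed:
  assumes "finite T"
  shows "finite (headed T)"
proof (rule finite_subset)
  define K where "K = Suc (Max T)"
  show "headed T \<subseteq> {xs. set xs \<subseteq> {..<K} \<and> distinct xs}"
  proof
    fix xs assume xs: "xs \<in> headed T"
    show "xs \<in> {xs. set xs \<subseteq> {..<K} \<and> distinct xs}"
    proof (cases xs)
      case (Cons y ys)
      with xs assms have "y \<le> Max T" "sorted_wrt (>) xs"
        by (auto simp: headed_def dest: admissible_decreasing)
      then show ?thesis using Cons
        by (auto simp: K_def distinct_if_decreasing)
    qed simp
  qed
qed (simp add: finite_subset_distinct)

lemma gf_empty [simp]: "gf a b q {} = 1"
proof -
  have "headed {} = {[]}" by (auto simp: headed_def admissible_def)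
  then show ?thesis by (simp add: gf_def)
qed

text \<open>A list with head \<open>k\<close> is \<open>k\<close> followed by a list that may follow
  it; 0 and 2 are forbidden parts and add nothing. Since only heads are constrained by
  \<open>T\<close>, \<open>k\<close> need not exceed the elements of \<open>T\<close>.\<close>

lemma gf_insert:
  assumes "finite T" "k \<notin> T"
  shows "gf a b q (insert k T) = gf a b q T +
    (if k = 0 \<or> k = 2 then 0 else part_wt a b q k * gf a b q {j. diff_ok k j})"
proof -
  define C where "C = (if k = 0 \<or> k = 2 then {} else (#) k ` headed {j. diff_ok k j})"
  have eq: "headed (insert k T) = headed T \<union> C"
  proof (intro set_eqI iffI)
    fix xs assume "xs \<in> headed (insert k T)"
    then show "xs \<in> headed T \<union> C"
      by (cases xs) (auto simp: headed_def C_def admissible_Cons image_iff)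
  next
    fix xs assume "xs \<in> headed T \<union> C"
    then show "xs \<in> headed (insert k T)"
      by (cases xs) (auto simp: headed_def C_def admissible_Cons split: if_splits)
  qed
  have "headed T \<inter> C = {}" using assms by (auto simp: headed_def C_def split: if_splits)
  then have "gf a b q (insert k T) = gf a b q T + (\<Sum>xs\<in>C. prod_list (map (part_wt a b q) xs))"
    unfolding gf_def eq using assms by (subst sum.union_disjoint) (auto simp: finite_headed C_def)
  also have "(\<Sum>xs\<in>C. prod_list (map (part_wt a b q) xs)) =
      (if k = 0 \<or> k = 2 then 0 else part_wt a b q k * gf a b q {j. diff_ok k j})"
    by (simp add: C_def gf_def sum.reindex sum_distrib_left)
  finally show ?thesis .
qed

section \<open>Successor sets and linear recurrences\<close>

text \<open>Few successor sets occur: in the integers, \<open>8*m+4\<close>, \<open>8*m+7\<close>,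
  \<open>8*m+10\<close> admit \<open>8*m-1\<close> and everything up to \<open>8*m-3\<close>, while
  \<open>8*m+5\<close>, \<open>8*m+6\<close>, \<open>8*m+8\<close> admit in addition
  \<open>8*m\<close>, \<open>8*m+2\<close>, \<open>8*m+3\<close>.\<close>

lemma diff_ok_shift:
  "diff_ok (8*m+7) j \<longleftrightarrow> diff_ok (8*m+4) j"
  "diff_ok (8*m+10) j \<longleftrightarrow> diff_ok (8*m+4) j"
  "diff_ok (8*m+6) j \<longleftrightarrow> diff_ok (8*m+5) j"
  "diff_ok (8*m+8) j \<longleftrightarrow> diff_ok (8*m+5) j"
  by (auto simp: diff_ok_def Let_def mod_add_eq[symmetric])

text \<open>The subtraction is truncated at \<open>m = 0\<close>, but \<open>ell a b q 0\<close> only occurs with the factor \<open>q\<^sup>0 - 1\<close>.\<close>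

definition ell :: "'a::comm_ring_1 \<Rightarrow> 'a \<Rightarrow> 'a \<Rightarrow> nat \<Rightarrow> 'a" where
  "ell a b q m = gf a b q {..<8*m-3}"

definition alpha :: "'a::comm_ring_1 \<Rightarrow> 'a \<Rightarrow> 'a \<Rightarrow> nat \<Rightarrow> 'a" where
  "alpha a b q m = gf a b q {j. diff_ok (8*m+4) j}"

text \<open>Introduced for the recurrences and eliminated again by \<open>beta_eq\<close>.\<close>

definition beta :: "'a::comm_ring_1 \<Rightarrow> 'a \<Rightarrow> 'a \<Rightarrow> nat \<Rightarrow> 'a" where
  "beta a b q m = gf a b q {j. diff_ok (8*m+5) j}"

lemma diff_ok_sets:
  "{j. diff_ok (8*m+12) j} = insert (8*m+7) (insert (8*m+5) {..<8*m+5})"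
  "{j. diff_ok (8*m+13) j} = insert (8*m+11) (insert (8*m+10) (insert (8*m+8) {j. diff_ok (8*m+12) j}))"
  "{j. diff_ok (8*m+11) j} = {..<8*m+5}"
  "{j. diff_ok (8*m+9) j} = insert (8*m+7) {..<8*m+5}"
  "{..<8*m+13} = insert (8*m+12) (insert (8*m+9) (insert (8*m+6) {j. diff_ok (8*m+13) j}))"
  by (auto simp: diff_ok_def Let_def)

lemma beta_0: "beta a b q 0 = 1 + a*q^3"
proof -
  have "{j. diff_ok 5 j} = insert 3 (insert 2 (insert 0 {}))" "diff_ok 3 = (\<lambda>_. False)"
    by (auto simp: diff_ok_def Let_def)
  then show ?thesis by (simp add: beta_def gf_insert part_wt_def mult1_def mult3_def)
qed

lemma alpha_0 [simp]: "alpha a b q 0 = 1"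
proof -
  have "{j. diff_ok 4 j} = {}" by (auto simp: diff_ok_def Let_def)
  then show ?thesis by (simp add: alpha_def)
qed

lemma ell_1: "ell a b q 1 = (1 + b*q) * (1 + a*q^3)"
proof -
  have "{..<5::nat} = insert 4 (insert 3 (insert 2 (insert 1 (insert 0 {}))))"
    "diff_ok 4 = (\<lambda>_. False)" "diff_ok 3 = (\<lambda>_. False)" "diff_ok (Suc 0) = (\<lambda>_. False)"
    by (auto simp: diff_ok_def Let_def)
  then show ?thesis by (simp add: ell_def gf_insert part_wt_def mult1_def mult3_def
    algebra_simps power_numeral_reduce)
qed

lemma gf_sets_Suc:
  "alpha a b q (m+1) = gf a b q {j. diff_ok (8*m+12) j}"
  "beta a b q (m+1) = gf a b q {j. diff_ok (8*m+13) j}"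
  "ell a b q (m+1) = gf a b q {..<8*m+5}"
  "ell a b q (m+2) = gf a b q {..<8*m+13}"
  by (simp_all add: alpha_def beta_def ell_def add.commute)

lemma alpha_Suc: "alpha a b q (m+1) =
  ell a b q (m+1) + b*q^(8*m+5) * beta a b q m + a*q^(8*m+7)*alpha a b q m"
proof -
  have "alpha a b q (m+1) = gf a b q {..<8*m+5}
     + part_wt a b q (8*m+5) * gf a b q {j. diff_ok (8*m+5) j}
     + part_wt a b q (8*m+7) * gf a b q {j. diff_ok (8*m+7) j}"
    unfolding gf_sets_Suc by (simp add: diff_ok_sets(1) gf_insert)
  then show ?thesis
    unfolding gf_sets_Suc
    by (simp add: alpha_def ell_def beta_def diff_ok_shift power2_eq_square part_wt_shift
      mult1_def mult3_def)
qed

lemma beta_Suc: "beta a b q (m+1) =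
  alpha a b q (m+1) + a*b*q^(8*m+8) * beta a b q m
  + a^2*q^(8*m+10)*alpha a b q m + a*q^(8*m+11)*ell a b q (m+1)"
proof -
  have *: "8*m+8 \<notin> {j. diff_ok (8*m+12) j}"
    "8*m+10 \<notin> {j. diff_ok (8*m+12) j}" "8*m+11 \<notin> {j. diff_ok (8*m+12) j}"
    by (auto simp: diff_ok_sets)
  have "beta a b q (m+1) = gf a b q {j. diff_ok (8*m+12) j}
     + part_wt a b q (8*m+8) * gf a b q {j. diff_ok (8*m+8) j}
     + part_wt a b q (8*m+10) * gf a b q {j. diff_ok (8*m+10) j}
     + part_wt a b q (8*m+11) * gf a b q {j. diff_ok (8*m+11) j}"
    using * unfolding gf_sets_Suc diff_ok_sets(2) by (simp add: gf_insert)
  then show ?thesis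
    unfolding gf_sets_Suc
    by (simp add: alpha_def ell_def beta_def diff_ok_shift diff_ok_sets(3) power2_eq_square part_wt_shift
      mult1_def mult3_def)
qed

lemma ell_Suc: "ell a b q (m+2) =
  beta a b q (m+1) + b^2*q^(8*m+6) * beta a b q m
  + b*q^(8*m+9)*(ell a b q (m+1) + a*q^(8*m+7)*alpha a b q m)
  + a*b*q^(8*m+12)*alpha a b q (m+1)"
proof -
  have *: "8*m+6 \<notin> {j. diff_ok (8*m+13) j}"
    "8*m+9 \<notin> {j. diff_ok (8*m+13) j}" "8*m+12 \<notin> {j. diff_ok (8*m+13) j}"
    by (auto simp: diff_ok_sets)
  have "ell a b q (m+2) = gf a b q {j. diff_ok (8*m+13) j}
     + part_wt a b q (8*m+6) * gf a b q {j. diff_ok (8*m+6) j}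
     + part_wt a b q (8*m+9) * gf a b q {j. diff_ok (8*m+9) j}
     + part_wt a b q (8*m+12) * gf a b q {j. diff_ok (8*m+12) j}"
    using * unfolding gf_sets_Suc diff_ok_sets(5) by (simp add: gf_insert)
  moreover have "gf a b q {j. diff_ok (8*m+9) j} = gf a b q {..<8*m+5}
     + part_wt a b q (8*m+7) * gf a b q {j. diff_ok (8*m+7) j}"
    by (simp add: diff_ok_sets(4) gf_insert)
  ultimately show ?thesis
    unfolding gf_sets_Suc
    by (simp add: alpha_def ell_def beta_def diff_ok_shift power2_eq_square part_wt_shift
      mult1_def mult3_def)
qed

text \<open>In \<open>beta_Suc\<close> the terms for the parts \<open>8*m+8\<close> and
  \<open>8*m+10\<close> are \<open>a*q^3\<close> times those for \<open>8*m+5\<close> and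
  \<open>8*m+7\<close> in \<open>alpha_Suc\<close>, so together they equal \<open>a*q^3\<close>
  times \<open>alpha - ell\<close> at index \<open>m+1\<close>.\<close>

lemma beta_eq: "beta a b q m = (1 + a*q^3) * alpha a b q m + a*q^3*(q^(8*m)-1)*ell a b q m"
proof (cases m)
  case 0
  then show ?thesis by (simp add: beta_0)
next
  case (Suc k)
  show ?thesis
    unfolding Suc Suc_eq_plus1 beta_Suc alpha_Suc
    by (simp add: algebra_simps power_add power2_eq_square power_numeral_reduce)
qed

text \<open>With \<open>beta\<close> eliminated, this and \<open>ell_rec\<close> form a closed
  system in \<open>alpha\<close> and \<open>ell\<close>, whose coefficients depend on
  \<open>m\<close> only through \<open>q^(8*m)\<close>.\<close>

lemma alpha_rec:
  "alpha a b q (m+1) = ell a b q (m+1) + q^5*q^(8*m)*(b+a*q^2+a*b*q^3)*alpha a b q m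
    + a*b*q^8*q^(8*m)*(q^(8*m)-1)*ell a b q m"
  unfolding alpha_Suc beta_eq
  by (simp add: algebra_simps power_add power2_eq_square power_numeral_reduce)

lemma ell_rec:
  "ell a b q (m+2) = (1+a*q^11*q^(8*m)+b*q^9*q^(8*m)+a*b*q^12*q^(8*m))*ell a b q (m+1)
    +q^5*q^(8*m)*((1+b*q)*(1+a*q^3))*(b+a*q^2+a*b*q^11*q^(8*m))*alpha a b q m
    +a*b*q^8*q^(8*m)*(1+a*q^3+b*q+a*b*q^12*q^(8*m))*(q^(8*m)-1)*ell a b q m"
  unfolding ell_Suc beta_eq alpha_rec
  by (simp add: algebra_simps power_add power2_eq_square power_numeral_reduce)

section \<open>The shift from \<open>a\<close>, \<open>b\<close> to \<open>a*q^4\<close>,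
  \<open>b*q^4\<close>\<close>

text \<open>The names \<open>lh\<close> and \<open>ah\<close> stand for \<open>ell\<close> and \<open>alpha\<close> at \<open>(a q\<^sup>4, b q\<^sup>4)\<close>, and \<open>X\<close> for \<open>q\<^bsup>8m\<^esup>\<close>.\<close>

lemma ell_alpha_shift_step:
  fixes a b q X :: "'a::comm_ring_1"
  defines "c \<equiv> (1 + b*q) * (1 + a*q^3)"
  assumes h: "l1 = c * ah0" "l2 = c * ah1"
   "al1 = lh1 + a*b*q^8*(X-1)*lh0 + (b*q + a*q^3 + a*b*q^4*(1+q^4-q^8*X))*ah0"
   "ah1 = lh1 + q^9*X*(b+a*q^2+a*b*q^7)*ah0+a*b*q^16*X*(X-1)*lh0"
   "ah2 = lh2 + q^17*X*(b+a*q^2+a*b*q^7)*ah1+a*b*q^24*X*(q^8*X-1)*lh1"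
   "lh2 = (1+a*q^15*X+b*q^13*X+a*b*q^20*X)*lh1
      +q^9*X*((1+b*q^5)*(1+a*q^7))*(b+a*q^2+a*b*q^15*X)*ah0
      +a*b*q^16*X*(1+a*q^7+b*q^5+a*b*q^20*X)*(X-1)*lh0"
   "al2 = l2 + q^13*X*(b+a*q^2+a*b*q^3)*al1+a*b*q^16*X*(q^8*X-1)*l1"
   "l3 = (1+a*q^19*X+b*q^17*X+a*b*q^20*X)*l2
      +q^13*X*c*(b+a*q^2+a*b*q^19*X)*al1
      +a*b*q^16*X*(1+a*q^3+b*q+a*b*q^20*X)*(q^8*X-1)*l1"
  shows "l3 = c * ah2"
   "al2 = lh2 + a*b*q^8*(q^8*X-1)*lh1 + (b*q + a*q^3 + a*b*q^4*(1+q^4-q^16*X))*ah1"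
proof -
  \<comment> \<open>This is the recurrence \<open>h(8)\<close> for \<open>l3\<close> with
    \<open>l1\<close>, \<open>l2\<close> replaced and the factor \<open>c\<close> removed. It is
    verified directly, since \<open>c\<close> need not be cancellable.\<close>
  have e: "(1+a*q^19*X+b*q^17*X+a*b*q^20*X)*ah1
      +q^13*X*(b+a*q^2+a*b*q^19*X)*al1
      +a*b*q^16*X*(1+a*q^3+b*q+a*b*q^20*X)*(q^8*X-1)*ah0 = ah2"
    unfolding h(3-6) by (simp add: algebra_simps power2_eq_square power_numeral_reduce)
  show "l3 = c * ah2" unfolding h(8) h(1,2) e[symmetric] by (simp add: algebra_simps)
  show "al2 = lh2 + a*b*q^8*(q^8*X-1)*lh1 + (b*q + a*q^3 + a*b*q^4*(1+q^4-q^16*X))*ah1"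
    unfolding h(7) h(1-6) c_def by (simp add: algebra_simps power2_eq_square power_numeral_reduce)
qed

lemma alpha_rec_shift:
  "alpha (a*q^4) (b*q^4) q (m+1) = ell (a*q^4) (b*q^4) q (m+1)
    + q^9*q^(8*m)*(b+a*q^2+a*b*q^7)*alpha (a*q^4) (b*q^4) q m
    + a*b*q^16*q^(8*m)*(q^(8*m)-1)*ell (a*q^4) (b*q^4) q m"
  unfolding alpha_rec
  by (simp add: algebra_simps power2_eq_square power_numeral_reduce)

lemma ell_rec_shift:
  "ell (a*q^4) (b*q^4) q (m+2) =
    (1+a*q^15*q^(8*m)+b*q^13*q^(8*m)+a*b*q^20*q^(8*m))*ell (a*q^4) (b*q^4) q (m+1)
    +q^9*q^(8*m)*((1+b*q^5)*(1+a*q^7))*(b+a*q^2+a*b*q^15*q^(8*m))*alpha (a*q^4) (b*q^4) q m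
    +a*b*q^16*q^(8*m)*(1+a*q^7+b*q^5+a*b*q^20*q^(8*m))*(q^(8*m)-1)*ell (a*q^4) (b*q^4) q m"
  unfolding ell_rec
  by (simp add: algebra_simps power2_eq_square power_numeral_reduce)

text \<open>The relation for \<open>alpha\<close> is what remains, after division by a common factor, when the
  first relation is inserted into the recurrences; it is needed to close the induction.\<close>

lemma ell_alpha_shift:
  fixes a b q :: "'a::comm_ring_1"
  defines "c \<equiv> (1 + b*q) * (1 + a*q^3)"
    and "l \<equiv> ell (a*q^4) (b*q^4) q" and "h \<equiv> alpha (a*q^4) (b*q^4) q"
  shows "ell a b q (m+1) = c * h m \<and> ell a b q (m+2) = c * h (m+1) \<and>
    alpha a b q (m+1) = l (m+1) + a*b*q^8*(q^(8*m)-1)*l m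
      + (b*q + a*q^3 + a*b*q^4*(1+q^4-q^8*q^(8*m)))*h m"
\<comment> \<open>The recurrence for \<open>ell\<close> reaches back two indices, hence the two
  instances of the first relation.\<close>
proof (induction m)
  case 0
  have h: "h 0 = 1" "h 1 = (1 + b*q^5)*(1 + a*q^7) + q^9*(b+a*q^2+a*b*q^7)"
    unfolding h_def using alpha_rec_shift[of a q b 0]
    by (simp_all add: ell_1[unfolded One_nat_def] algebra_simps power_numeral_reduce)
  have "ell a b q 1 = c" "l 1 = (1 + b*q^5)*(1 + a*q^7)"
    unfolding ell_1 c_def l_def by (simp_all add: algebra_simps power_numeral_reduce)
  then show ?case using ell_rec[of a b q 0] alpha_rec[of a b q 0] h
    by (simp add: c_def numeral_2_eq_2 algebra_simps power_numeral_reduce)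
next
  case (Suc m)
  define X where "X = q^(8*m)"
  \<comment> \<open>Raising the index by 1 replaces \<open>X\<close> by \<open>q^8*X\<close>, which
    explains the exponents in \<open>hat1\<close>, \<open>r1\<close>, \<open>r2\<close>.\<close>
  have X: "q^(8*(m+1)) = q^8*X" by (simp add: X_def power_add)
  have idx: "m + 1 + 1 = m + 2" "m + 1 + 2 = m + 3" by simp_all
  note hyps = conjunct1[OF Suc] conjunct1[OF conjunct2[OF Suc]] conjunct2[OF conjunct2[OF Suc]]
  note hat0 = alpha_rec_shift[of a q b m, folded l_def h_def X_def]
  have hat1: "h (m+2) = l (m+2) + q^17*X*(b+a*q^2+a*b*q^7)*h (m+1)
      + a*b*q^24*X*(q^8*X-1)*l (m+1)"
    using alpha_rec_shift[of a q b "m+1", folded l_def h_def, unfolded X idx]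
    by (simp add: mult.assoc)
  note hat2 = ell_rec_shift[of a q b m, folded l_def h_def X_def]
  have r1: "alpha a b q (m+2) = ell a b q (m+2) + q^13*X*(b+a*q^2+a*b*q^3)*alpha a b q (m+1)
      + a*b*q^16*X*(q^8*X-1)*ell a b q (m+1)"
    using alpha_rec[of a b q "m+1", unfolded X idx]
    by (simp add: mult.assoc)
  have r2: "ell a b q (m+3) = (1+a*q^19*X+b*q^17*X+a*b*q^20*X)*ell a b q (m+2)
      + q^13*X*c*(b+a*q^2+a*b*q^19*X)*alpha a b q (m+1)
      + a*b*q^16*X*(1+a*q^3+b*q+a*b*q^20*X)*(q^8*X-1)*ell a b q (m+1)"
    using ell_rec[of a b q "m+1", unfolded X idx, folded c_def]
    by (simp add: mult.assoc)
  have "ell a b q (m+3) = c * h (m+2)"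
    "alpha a b q (m+2) = l (m+2) + a*b*q^8*(q^8*X-1)*l (m+1)
      + (b*q + a*q^3 + a*b*q^4*(1+q^4-q^16*X))*h (m+1)"
    using ell_alpha_shift_step[OF hyps(1,2)[unfolded c_def] hyps(3)[folded X_def]
        hat0 hat1 hat2 r1 r2[unfolded c_def]]
    unfolding c_def by blast+
  then show ?case
    using hyps(2) X by (simp add: numeral_3_eq_3 power_add)
qed

section \<open>Congruences modulo powers of \<open>q\<close>\<close>

text \<open>For every residue modulo 8 the weight of a part has a factor \<open>a\<close> or
  \<open>b\<close>, so modulo \<open>d\<close> only the empty list survives.\<close>

lemma gf_cong_1:
  assumes "finite T" "d dvd a" "d dvd b"
  shows "d dvd gf a b q T - 1"
proof -
  have "[] \<in> headed T" by (simp add: headed_def admissible_def)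
  then have "gf a b q T - 1 = (\<Sum>xs\<in>headed T - {[]}. prod_list (map (part_wt a b q) xs))"
    using assms(1) by (simp add: gf_def finite_headed sum.remove)
  moreover have "d dvd prod_list (map (part_wt a b q) xs)" if xs: "xs \<noteq> []" for xs
  proof -
    obtain k ys where "xs = k # ys" using xs by (cases xs) auto
    moreover have "d dvd part_wt a b q k"
    proof (cases "mult3 k = 0")
      case True
      then have "mult1 k > 0" by (auto simp: mult3_def mult1_def split: if_splits; presburger)
      then have "d dvd b ^ mult1 k" using assms by (meson dvd_power dvd_trans)
      then show ?thesis by (simp add: part_wt_def)
    next
      case False
      then have "d dvd a ^ mult3 k" using assms by (meson dvd_power dvd_trans not_gr0)
      then show ?thesis by (simp add: part_wt_def)
    qed
    ultimately show ?thesis by simp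
  qed
  ultimately show ?thesis by (auto intro: dvd_sum)
qed

text \<open>Apart from the leading \<open>ell\<close> at index \<open>m+1\<close>, all terms of
  \<open>alpha_rec\<close> carry \<open>q^(8*m+5)\<close>; the same holds for \<open>ell_rec\<close>
  in \<open>ell_step_cong\<close>.\<close>

lemma alpha_ell_cong: "q^(8*m+5) dvd alpha a b q (m+1) - ell a b q (m+1)"
proof -
  have "alpha a b q (m+1) - ell a b q (m+1) = q^(8*m+5) * ((b+a*q^2+a*b*q^3)*alpha a b q m
    + a*b*q^3*(q^(8*m)-1)*ell a b q m)"
    unfolding alpha_rec by (simp add: algebra_simps power_add power_numeral_reduce)
  then show ?thesis by simp
qed

lemma ell_step_cong: "q^(8*m+5) dvd ell a b q (m+2) - ell a b q (m+1)"
proof -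
  have "ell a b q (m+2) - ell a b q (m+1) = q^(8*m+5) * ((a*q^6+b*q^4+a*b*q^7)*ell a b q (m+1)
    +((1+b*q)*(1+a*q^3))*(b+a*q^2+a*b*q^11*q^(8*m))*alpha a b q m
    +a*b*q^3*(1+a*q^3+b*q+a*b*q^12*q^(8*m))*(q^(8*m)-1)*ell a b q m)"
    unfolding ell_rec by (simp add: algebra_simps power_add power_numeral_reduce)
  then show ?thesis by simp
qed

text \<open>The shift identity yields \<open>alpha\<close> at \<open>m+1\<close>; trading it for
  \<open>ell\<close> at \<open>m+2\<close> puts the same index on both sides, so that the congruence
  can be iterated with fixed modulus.\<close>

lemma ell_shift_cong:
  "q^(8*m+5) dvd ell a b q (m+2) - (1+b*q)*(1+a*q^3) * ell (a*q^4) (b*q^4) q (m+2)"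
proof -
  define c where "c = (1+b*q)*(1+a*q^3)"
  define l where "l = ell (a*q^4) (b*q^4) q"
  define h where "h = alpha (a*q^4) (b*q^4) q"
  have "ell a b q (m+2) = c * h (m+1)"
    unfolding c_def h_def using ell_alpha_shift[of a b q m] by simp
  then have "ell a b q (m+2) - c * l (m+2) = c * ((h (m+1) - l (m+1)) - (l (m+2) - l (m+1)))"
    by (simp add: algebra_simps)
  moreover have "q^(8*m+5) dvd (h (m+1) - l (m+1)) - (l (m+2) - l (m+1))"
    unfolding h_def l_def using alpha_ell_cong ell_step_cong by (rule dvd_diff)
  ultimately show ?thesis by (simp add: c_def l_def)
qed

lemma ell_iterate_cong:
  "q^(8*m+5) dvd ell a b q (m+2) -
    (\<Prod>j<J. (1 + b*q^(4*j+1)) * (1 + a*q^(4*j+3))) * ell (a*q^(4*J)) (b*q^(4*J)) q (m+2)"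
proof (induction J)
  case (Suc J)
  define P where "P = (\<Prod>j<J. (1 + b*q^(4*j+1)) * (1 + a*q^(4*j+3)))"
  define c where "c = (1 + b*q^(4*J+1)) * (1 + a*q^(4*J+3))"
  define l where "l = (\<lambda>J. ell (a*q^(4*J)) (b*q^(4*J)) q (m+2))"
  have "q^(8*m+5) dvd l J - c * l (Suc J)"
    using ell_shift_cong[of q m "a*q^(4*J)" "b*q^(4*J)"]
    by (simp add: l_def c_def power_add algebra_simps)
  then have "q^(8*m+5) dvd (ell a b q (m+2) - P * l J) + P * (l J - c * l (Suc J))"
    using Suc by (intro dvd_add dvd_mult) (simp_all add: P_def l_def)
  then show ?case by (simp add: P_def c_def l_def algebra_simps)
qed simp

section \<open>Product expansion and exponents of the weights\<close>

text \<open>Expanding the product selects a set of odd numbers. An odd part carries exactly one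
  factor \<open>a\<close> or \<open>b\<close>, so \<open>part_wt\<close> weighs both kinds of
  partitions.\<close>

lemma prod_odd_parts:
  "(\<Prod>j<J. (1 + b*q^(4*j+1)) * (1 + a*q^(4*j+3))) =
    (\<Sum>S\<in>Pow {k. odd k \<and> k < 4*J}. \<Prod>k\<in>S. part_wt a b q k)"
proof -
  have "(\<Prod>j<J. (1 + b*q^(4*j+1)) * (1 + a*q^(4*j+3))) =
    (\<Prod>k | odd k \<and> k < 4*J. part_wt a b q k + 1)"
  proof (induction J)
    case (Suc J)
    have eq: "{k. odd k \<and> k < 4*Suc J} = insert (4*J+1) (insert (4*J+3) {k. odd k \<and> k < 4*J})"
      by (auto; presburger)
    have "(4*J+1) mod 4 = 1" "(4*J+3) mod 4 = 3" "(4*J+1) mod 8 \<noteq> 2" "(4*J+3) mod 8 \<noteq> 2"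
      "(4*J+1) mod 8 \<noteq> 6" "(4*J+3) mod 8 \<noteq> 6" by presburger+
    then have "part_wt a b q (4*J+1) = b * q^(4*J+1)" "part_wt a b q (4*J+3) = a * q^(4*J+3)"
      by (simp_all add: part_wt_def mult3_def mult1_def)
    then show ?case unfolding eq prod.lessThan_Suc Suc by (simp add: algebra_simps)
  qed simp
  also have "\<dots> = (\<Sum>S\<in>Pow {k. odd k \<and> k < 4*J}. \<Prod>k\<in>S. part_wt a b q k)"
    by (subst prod_add) auto
  finally show ?thesis .
qed

lemma prod_list_part_wt:
  "prod_list (map (part_wt a b q) xs) =
    a ^ sum_list (map mult3 xs) * b ^ sum_list (map mult1 xs) * q ^ sum_list xs"
  by (induction xs) (simp_all add: part_wt_def power_add mult_ac)

lemma prod_part_wt: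
  "(\<Prod>k\<in>S. part_wt a b q k) = a ^ sum mult3 S * b ^ sum mult1 S * q ^ \<Sum>S"
  by (simp add: part_wt_def prod.distrib power_sum)

lemma sum_list_mult:
  "sum_list (map mult3 xs) = length (filter (\<lambda>x. x mod 4 = 0 \<or> x mod 4 = 3) xs)
    + 2 * length (filter (\<lambda>x. x mod 8 = 2) xs)"
  "sum_list (map mult1 xs) = length (filter (\<lambda>x. x mod 4 = 0 \<or> x mod 4 = 1) xs)
    + 2 * length (filter (\<lambda>x. x mod 8 = 6) xs)"
  by (induction xs) (auto simp: mult3_def mult1_def)

lemma sum_mult_odd:
  assumes "finite S" "\<forall>k\<in>S. odd k"
  shows "sum mult3 S = card {k\<in>S. k mod 4 = 3}" "sum mult1 S = card {k\<in>S. k mod 4 = 1}"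
proof -
  have *: "mult3 k = (if k mod 4 = 3 then 1 else 0)" "mult1 k = (if k mod 4 = 1 then 1 else 0)"
    if "k \<in> S" for k
  proof -
    have "odd k" using that assms(2) by blast
    then have "k mod 4 \<noteq> 0" "k mod 8 \<noteq> 2" "k mod 8 \<noteq> 6" by presburger+
    then show "mult3 k = (if k mod 4 = 3 then 1 else 0)" "mult1 k = (if k mod 4 = 1 then 1 else 0)"
      by (simp_all add: mult3_def mult1_def)
  qed
  show "sum mult3 S = card {k\<in>S. k mod 4 = 3}" "sum mult1 S = card {k\<in>S. k mod 4 = 1}"
    using assms(1) by (simp_all add: * sum.inter_filter[symmetric] cong: sum.cong)
qed

section \<open>Coefficient extraction in three variables\<close>

text \<open>The variable \<open>q\<close> is outermost and \<open>b\<close> innermost, so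
  coefficients are taken at \<open>n\<close>, then \<open>u\<close>, then \<open>v\<close>.\<close>

abbreviation ind_a :: "int poly poly poly" where "ind_a \<equiv> monom (monom 1 1) 0"
abbreviation ind_b :: "int poly poly poly" where "ind_b \<equiv> monom (monom (monom 1 1) 0) 0"
abbreviation ind_q :: "int poly poly poly" where "ind_q \<equiv> monom 1 1"

lemma coeff_sum_monomials:
  assumes "finite S"
  shows "coeff (coeff (coeff (\<Sum>s\<in>S. ind_a ^ f s * ind_b ^ g s * ind_q ^ h s) n) u) v =
    int (card {s\<in>S. f s = u \<and> g s = v \<and> h s = n})"
proof -
  have "coeff (coeff (coeff (ind_a ^ f s * ind_b ^ g s * ind_q ^ h s) n) u) v =
      (if f s = u \<and> g s = v \<and> h s = n then 1 else 0)" for s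
    by (simp add: monom_power mult_monom)
  then show ?thesis
    using assms by (simp add: coeff_sum sum.inter_filter[symmetric])
qed

text \<open>No part of a partition of \<open>n\<close> exceeds \<open>n\<close>, so \<open>J\<close>
  factors suffice; \<open>D4'_eq_coeff\<close> bounds the head in the same way.\<close>

lemma C4'_eq_coeff:
  assumes "n < 4*J"
  shows "int (C4' u v n) =
    coeff (coeff (coeff (\<Prod>j<J. (1 + ind_b*ind_q^(4*j+1)) * (1 + ind_a*ind_q^(4*j+3))) n) u) v"
proof -
  define K where "K = {k. odd k \<and> k < 4*J}"
  have odd: "odd k \<longleftrightarrow> k mod 4 = 1 \<or> k mod 4 = 3" for k :: nat by presburger
  have "{S. finite S \<and> (\<forall>x\<in>S. x mod 4 = 1 \<or> x mod 4 = 3) \<and> \<Sum>S = n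
      \<and> card {x\<in>S. x mod 4 = 3} = u \<and> card {x\<in>S. x mod 4 = 1} = v} =
    {S\<in>Pow K. sum mult3 S = u \<and> sum mult1 S = v \<and> \<Sum>S = n}" (is "?L = ?R")
  proof (intro set_eqI iffI)
    fix S assume S: "S \<in> ?L"
    then have o: "finite S" "\<forall>k\<in>S. odd k" by (auto simp: odd)
    moreover have "k < 4*J" if "k \<in> S" for k
      using member_le_sum[of k S id] that S assms by auto
    ultimately show "S \<in> ?R" using S by (auto simp: K_def sum_mult_odd[OF o])
  next
    fix S assume S: "S \<in> ?R"
    then have o: "finite S" "\<forall>k\<in>S. odd k"
      by (auto simp: K_def intro: finite_subset[of S "{..<4*J}"])
    then show "S \<in> ?L" using S by (auto simp: sum_mult_odd[OF o] odd)
  qed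
  moreover have "finite K" by (simp add: K_def)
  ultimately show ?thesis
    unfolding C4'_def prod_odd_parts K_def[symmetric] prod_part_wt
    by (subst coeff_sum_monomials) auto
qed

lemma D4'_eq_coeff:
  assumes "n < K"
  shows "int (D4' u v n) = coeff (coeff (coeff (gf ind_a ind_b ind_q {..<K}) n) u) v"
proof -
  have "{xs. sorted_wrt (\<ge>) xs \<and> (\<forall>x\<in>set xs. x > 0) \<and> sum_list xs = n \<and> (\<forall>x\<in>set xs. x \<noteq> 2)
      \<and> (\<forall>i. i + 1 < length xs \<longrightarrow> diff_ok (xs ! i) (xs ! (i + 1)))
      \<and> u = sum_list (map mult3 xs) \<and> v = sum_list (map mult1 xs)} =
    {xs\<in>headed {..<K}. sum_list (map mult3 xs) = u \<and> sum_list (map mult1 xs) = v \<and> sum_list xs = n}"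
    (is "?L = ?R")
  proof (intro set_eqI iffI)
    fix xs assume xs: "xs \<in> ?L"
    then have "admissible xs" by (auto simp: admissible_def successively_conv_nth)
    moreover have "hd xs < K" if "xs \<noteq> []"
      using that xs assms by (cases xs) auto
    ultimately show "xs \<in> ?R" using xs by (auto simp: headed_def)
  next
    fix xs assume xs: "xs \<in> ?R"
    then have "admissible xs" by (simp add: headed_def)
    moreover from this have "sorted_wrt (\<ge>) xs"
      by (rule sorted_wrt_mono_rel[OF _ admissible_decreasing, rotated]) auto
    ultimately show "xs \<in> ?L" using xs
      by (auto simp: admissible_def successively_conv_nth intro!: gr0I)
  qed
  then show ?thesis
    unfolding D4'_def gf_def prod_list_part_wt sum_list_mult[symmetric]
    by (subst coeff_sum_monomials) (auto simp: finite_headed)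
qed

theorem theorem1p9:
  fixes u v n :: nat
  shows "C4' u v n = D4' u v n"
proof -
  \<comment> \<open>Modulo \<open>ind_q ^ (n+1)\<close> the coefficient at \<open>n\<close> is
    preserved. Index \<open>n+2\<close> for \<open>ell\<close> gives the congruence modulo
    \<open>ind_q ^ (8*n+5)\<close>, which is strong enough, and allows all parts up to
    \<open>n\<close>.\<close>
  define J where "J = n + 1"
  define P where "P = (\<Prod>j<J. (1 + ind_b*ind_q^(4*j+1)) * (1 + ind_a*ind_q^(4*j+3)))"
  define G where "G = ell ind_a ind_b ind_q (n+2)"
  define G' where "G' = ell (ind_a*ind_q^(4*J)) (ind_b*ind_q^(4*J)) ind_q (n+2)"
  have "ind_q ^ J dvd G - P * G'"
    unfolding G_def P_def G'_def
    by (rule dvd_trans[OF le_imp_power_dvd ell_iterate_cong]) (simp add: J_def)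
  \<comment> \<open>After \<open>J\<close> shifts both weights contain \<open>ind_q^(4*J)\<close>,
    so \<open>gf_cong_1\<close> applies with \<open>d = ind_q ^ J\<close>.\<close>
  moreover have "ind_q ^ J dvd G' - 1"
    unfolding G'_def ell_def by (rule gf_cong_1) (auto intro!: dvd_mult le_imp_power_dvd)
  ultimately have "ind_q ^ J dvd (G - P * G') + P * (G' - 1)"
    by (intro dvd_add dvd_mult)
  then have "monom 1 J dvd G - P"
    by (simp add: algebra_simps monom_power)
  then have "coeff G n = coeff P n"
    by (simp add: monom_1_dvd_iff' J_def)
  then have "int (C4' u v n) = int (D4' u v n)"
    using C4'_eq_coeff[of n J u v] D4'_eq_coeff[of n "8*(n+2)-3" u v]
    by (simp add: G_def P_def ell_def J_def)
  then show ?thesis by simp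
qed

end
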